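(* Let $\Gamma\cup\{A\}$ be a set of formulas. If $\Gamma\Vdash A$, then $\Gamma\vdash_{pml}A$.
   Context: Formulas. Let $\mathcal V_m$ (minimal variables), $\mathcal V_i$ (intuitionistic variables), $\mathcal V_c$ (classical variables) be three disjoint countable sets of propositional variables and $\perp$ a special constant; put $\mathcal P=\mathcal V_m\cup\mathcal V_i\cup\mathcal V_c\cup\{\perp\}$. Formulas are built inductively from elements of $\mathcal P$ using $\wedge,\vee,\to$; $\neg A$ abbreviates $A\to\perp$. $var(A)$ is the set of variables of $A$ (so $\perp$ is not counted). $A$ is a classical formula if $var(A)\subseteq\mathcal V_c$, and an intuitionistic formula if $var(A)\subseteq\mathcal V_i\cup\mathcal V_c$. The system PML. A simple sequent is $\Gamma\vdash A$ with $\Gamma\cup\{A\}$ a finite set of formulas; commas denote union. Rules ($j\in\{1,2\}$): (Ax) $A\vdash A$; (W) from $\Gamma\vdash A$ infer $\Gamma,B\vdash A$; ($\wedge_I$) from $\Gamma_1\vdash A_1$ and $\Gamma_2\vdash A_2$ infer $\Gamma_1,\Gamma_2\vdash A_1\wedge A_2$; ($\wedge_E$) from $\Gamma\vdash A_1\wedge A_2$ infer $\Gamma\vdash A_j$; ($\vee_I$) from $\Gamma\vdash A_j$ infer $\Gamma\vdash A_1\vee A_2$; ($\vee_E$) from $\Gamma_1\vdash A_1\vee A_2$, $\Gamma_2,A_1\vdash B$ and $\Gamma_3,A_2\vdash B$ infer $\Gamma_1,\Gamma_2,\Gamma_3\vdash B$; ($\to_I$) from $\Gamma,A_1\vdash A_2$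 infer $\Gamma\vdash A_1\to A_2$; ($\to_E$) from $\Gamma_1\vdash A_1\to A_2$ and $\Gamma_2\vdash A_1$ infer $\Gamma_1,\Gamma_2\vdash A_2$; ($\perp_i$) from $\Gamma\vdash\perp$ infer $\Gamma\vdash A$, provided $A$ is an intuitionistic formula; ($\perp_c$) from $\Gamma\vdash\neg\neg A$ infer $\Gamma\vdash A$, provided $A$ is a classical formula. $\Gamma\vdash_{pml}A$ means that $\Gamma\vdash A$ is derivable with these rules; for infinite $\Gamma$ it means that $\Gamma'\vdash_{pml}A$ for some finite $\Gamma'\subseteq\Gamma$. Semantics. A mixed Kripke model is a triple $\mathcal K=(K,\le,\Vdash)$ with $(K,\le)$ a nonempty partially ordered set and $\Vdash$ a binary relation on $K\times\mathcal P$ such that: (1) for $\chi\in\mathcal P$, if $\alpha\Vdash\chi$ and $\beta\ge\alpha$ then $\beta\Vdash\chi$; (2) if $\alpha\Vdash\perp$ then $\alpha\Vdash X$ for every $X\in\mathcal V_i\cup\mathcal V_c$; (3) for $X_c\in\mathcal V_c$, if $\alpha\Vdash X_c$ and $\alpha\not\Vdash\perp$, then $\beta\Vdash X_c$ for every $\beta\in K$. It is extended to formulas by: $\alpha\Vdash A\wedge B$ iff $\alpha\Vdash A$ and $\alpha\Vdash B$; $\alpha\Vdash A\vee B$ iff $\alpha\Vdash A$ or $\alpha\Vdash B$; $\alpha\Vdash A\to B$ iff for all $\beta\ge\alpha$, $\beta\Vdash A$ implies $\beta\Vdash B$. $\mathcal K\Vdash A$ ($A$ is valid in $\mathcal K$)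 means $\alpha\Vdash A$ for all $\alpha\in K$. For a set of formulas $\Gamma$, $\Gamma\Vdash A$ means: for every mixed Kripke model $\mathcal K$, if $\mathcal K\Vdash B$ for all $B\in\Gamma$, then $\mathcal K\Vdash A$. *)

theory Defs
  imports "HOL-Library.Countable"
begin

text \<open>
  The three sets of propositional variables are the three tagged copies \<open>Vm\<close>, \<open>Vi\<close>, \<open>Vc\<close> of
  the types \<open>'m\<close>, \<open>'i\<close>, \<open>'c\<close>, hence disjoint; countability is the sort constraint \<open>countable\<close>
  imposed where it is needed.
\<close>

datatype ('m, 'i, 'c) atom = MVar 'm | IVar 'i | CVar 'c | Falsum

definition Vm :: "('m, 'i, 'c) atom set" where "Vm = range MVar"
definition Vi :: "('m, 'i, 'c) atom set" where "Vi = range IVar"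
definition Vc :: "('m, 'i, 'c) atom set" where "Vc = range CVar"

datatype ('m, 'i, 'c) form =
    Atom "('m, 'i, 'c) atom"
  | Conj "('m, 'i, 'c) form" "('m, 'i, 'c) form"
  | Disj "('m, 'i, 'c) form" "('m, 'i, 'c) form"
  | Imp "('m, 'i, 'c) form" "('m, 'i, 'c) form"

abbreviation Bot :: "('m, 'i, 'c) form" where
  "Bot \<equiv> Atom Falsum"

abbreviation Neg :: "('m, 'i, 'c) form \<Rightarrow> ('m, 'i, 'c) form" where
  "Neg A \<equiv> Imp A Bot"

primrec var :: "('m, 'i, 'c) form \<Rightarrow> ('m, 'i, 'c) atom set" where
  "var (Atom p) = {p} - {Falsum}"
| "var (Conj A B) = var A \<union> var B"
| "var (Disj A B) = var A \<union> var B"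
| "var (Imp A B) = var A \<union> var B"

definition classical :: "('m, 'i, 'c) form \<Rightarrow> bool" where
  "classical A \<longleftrightarrow> var A \<subseteq> Vc"

definition intuitionistic :: "('m, 'i, 'c) form \<Rightarrow> bool" where
  "intuitionistic A \<longleftrightarrow> var A \<subseteq> Vi \<union> Vc"

text \<open>
  Antecedents of derivable sequents are automatically finite: \<open>Ax\<close> starts from a singleton and
  every rule preserves finiteness.
\<close>

inductive sequent :: "('m, 'i, 'c) form set \<Rightarrow> ('m, 'i, 'c) form \<Rightarrow> bool" where
  Ax: "sequent {A} A"
| W: "sequent G A \<Longrightarrow> sequent (G \<union> {B}) A"
| ConjI: "sequent G1 A1 \<Longrightarrow> sequent G2 A2 \<Longrightarrow> sequent (G1 \<union> G2) (Conj A1 A2)"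
| ConjE1: "sequent G (Conj A1 A2) \<Longrightarrow> sequent G A1"
| ConjE2: "sequent G (Conj A1 A2) \<Longrightarrow> sequent G A2"
| DisjI1: "sequent G A1 \<Longrightarrow> sequent G (Disj A1 A2)"
| DisjI2: "sequent G A2 \<Longrightarrow> sequent G (Disj A1 A2)"
| DisjE: "sequent G1 (Disj A1 A2) \<Longrightarrow> sequent (G2 \<union> {A1}) B \<Longrightarrow> sequent (G3 \<union> {A2}) B
    \<Longrightarrow> sequent (G1 \<union> G2 \<union> G3) B"
| ImpI: "sequent (G \<union> {A1}) A2 \<Longrightarrow> sequent G (Imp A1 A2)"
| ImpE: "sequent G1 (Imp A1 A2) \<Longrightarrow> sequent G2 A1 \<Longrightarrow> sequent (G1 \<union> G2) A2"
| BotI: "sequent G Bot \<Longrightarrow> intuitionistic A \<Longrightarrow> sequent G A"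
| BotC: "sequent G (Neg (Neg A)) \<Longrightarrow> classical A \<Longrightarrow> sequent G A"

definition pml :: "('m, 'i, 'c) form set \<Rightarrow> ('m, 'i, 'c) form \<Rightarrow> bool"
    (infix \<open>\<turnstile>pml\<close> 50) where
  "\<Gamma> \<turnstile>pml A \<longleftrightarrow>
     (if finite \<Gamma> then sequent \<Gamma> A else \<exists>\<Gamma>'. finite \<Gamma>' \<and> \<Gamma>' \<subseteq> \<Gamma> \<and> sequent \<Gamma>' A)"

text \<open>
  A model has a carrier \<open>K\<close> inside the type \<open>'w\<close>, an order \<open>le\<close> and a forcing relation \<open>F\<close>;
  only the restrictions of \<open>le\<close> and \<open>F\<close> to \<open>K\<close> matter.
\<close>

locale mixed_kripke_model =
  fixes K :: "'w set"
    and le :: "'w \<Rightarrow> 'w \<Rightarrow> bool"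
    and F :: "'w \<Rightarrow> ('m, 'i, 'c) atom \<Rightarrow> bool"
  assumes nonempty: "K \<noteq> {}"
    and le_refl: "reflp_on K le"
    and le_antisym: "antisymp_on K le"
    and le_trans: "transp_on K le"
    and persistent: "\<And>\<alpha> \<beta> \<chi>. \<alpha> \<in> K \<Longrightarrow> \<beta> \<in> K \<Longrightarrow> F \<alpha> \<chi> \<Longrightarrow> le \<alpha> \<beta> \<Longrightarrow> F \<beta> \<chi>"
    and explosive: "\<And>\<alpha> X. \<alpha> \<in> K \<Longrightarrow> F \<alpha> Falsum \<Longrightarrow> X \<in> Vi \<union> Vc \<Longrightarrow> F \<alpha> X"
    and decided: "\<And>\<alpha> \<beta> X. \<alpha> \<in> K \<Longrightarrow> \<beta> \<in> K \<Longrightarrow> X \<in> Vc \<Longrightarrow> F \<alpha> X \<Longrightarrow> \<not> F \<alpha> Falsum \<Longrightarrow> F \<beta> X"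

primrec forces :: "'w set \<Rightarrow> ('w \<Rightarrow> 'w \<Rightarrow> bool) \<Rightarrow> ('w \<Rightarrow> ('m, 'i, 'c) atom \<Rightarrow> bool) \<Rightarrow>
    'w \<Rightarrow> ('m, 'i, 'c) form \<Rightarrow> bool" where
  "forces K le F \<alpha> (Atom p) \<longleftrightarrow> F \<alpha> p"
| "forces K le F \<alpha> (Conj A B) \<longleftrightarrow> forces K le F \<alpha> A \<and> forces K le F \<alpha> B"
| "forces K le F \<alpha> (Disj A B) \<longleftrightarrow> forces K le F \<alpha> A \<or> forces K le F \<alpha> B"
| "forces K le F \<alpha> (Imp A B) \<longleftrightarrow>
     (\<forall>\<beta>\<in>K. le \<alpha> \<beta> \<longrightarrow> forces K le F \<beta> A \<longrightarrow> forces K le F \<beta> B)"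

definition valid_in :: "'w set \<Rightarrow> ('w \<Rightarrow> 'w \<Rightarrow> bool) \<Rightarrow> ('w \<Rightarrow> ('m, 'i, 'c) atom \<Rightarrow> bool) \<Rightarrow>
    ('m, 'i, 'c) form \<Rightarrow> bool" where
  "valid_in K le F A \<longleftrightarrow> (\<forall>\<alpha>\<in>K. forces K le F \<alpha> A)"

text \<open>
  HOL cannot quantify over types inside a formula, so consequence is relative to the type \<open>'w\<close>
  from which the worlds of the models are drawn. As a hypothesis, \<open>entails TYPE('w) \<Gamma> A\<close> for one
  particular \<open>'w\<close> is implied by consequence over all models whatsoever.
\<close>

definition entails :: "'w itself \<Rightarrow> ('m, 'i, 'c) form set \<Rightarrow> ('m, 'i, 'c) form \<Rightarrow> bool" where
  "entails TYPE('w) \<Gamma> A \<longleftrightarrow>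
     (\<forall>(K :: 'w set) le F. mixed_kripke_model K le F \<longrightarrow>
        (\<forall>B\<in>\<Gamma>. valid_in K le F B) \<longrightarrow> valid_in K le F A)"

end

theory Submission
  imports Defs
begin

text \<open>
  The theorem is strong completeness of mixed logic, proved contrapositively by a canonical model.
  If \<open>\<Gamma>\<close> does not derive \<open>A\<close>, Zorn's lemma extends \<open>\<Gamma>\<close> to a prime theory \<open>R\<close> omitting \<open>A\<close>
  (\<open>prime_extension\<close>). The worlds are the prime theories that include \<open>R\<close>, ordered by inclusion,
  and a world forces the atoms that it contains. The usual truth lemma \<open>forces_canonical_iff\<close>
  says that a world forces exactly its elements, so all of \<open>\<Gamma>\<close> is valid in the model while the
  world \<open>R\<close> refutes \<open>A\<close>.

  What is special to mixed logic is that this is a mixed Kripke model. Explosion at a world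
  containing \<open>\<bottom>\<close> is the rule for intuitionistic formulas. For the condition on classical variables
  it is essential to keep only the worlds above a single root. Excluded middle is derivable for a
  classical formula, so primeness makes \<open>R\<close> contain each classical variable or its negation. A
  variable that \<open>R\<close> negates can only hold at worlds containing \<open>\<bottom>\<close>, and one that \<open>R\<close> contains holds
  at all worlds: the classical variables are thus settled at the root.
\<close>

section \<open>Derivability from arbitrary sets of formulas\<close>

lemma sequent_finite: "sequent G A \<Longrightarrow> finite G"
  by (induction rule: sequent.induct) auto

lemma sequent_mono:
  assumes "sequent G A" "finite H" "G \<subseteq> H"
  shows "sequent H A"
proof -
  have "sequent (G \<union> D) A" if "finite D" for D
    using that
  proof (induction D rule: finite_induct)
    case empty
    then show ?case using assms(1) by simp
  next
    case (insert B D)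
    then show ?case using W[of "G \<union> D" A B] by simp
  qed
  from this[OF assms(2)] show ?thesis
    using assms(3) by (simp add: Un_absorb1)
qed

text \<open>
  Since antecedents are finite and weakening is a rule, the finite and the infinite case of
  derivability obey one compactness principle, which lets the rules be lifted uniformly.
\<close>

lemma pml_iff: "S \<turnstile>pml A \<longleftrightarrow> (\<exists>G\<subseteq>S. sequent G A)"
  unfolding pml_def by (auto intro: sequent_mono dest: sequent_finite)

lemma pml_assumption: "A \<in> S \<Longrightarrow> S \<turnstile>pml A"
  unfolding pml_iff using Ax by blast

lemma pml_insertE:
  assumes "insert A S \<turnstile>pml B"
  obtains G where "G \<subseteq> S" "sequent (G \<union> {A}) B"
proof -
  obtain G where G: "G \<subseteq> insert A S" "sequent G B"
    using assms unfolding pml_iff by blast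
  have "sequent ((G - {A}) \<union> {A}) B"
    using sequent_mono[OF G(2)] sequent_finite[OF G(2)] by auto
  then show thesis using that[of "G - {A}"] G(1) by blast
qed

lemma pml_ConjI: "S \<turnstile>pml A \<Longrightarrow> S \<turnstile>pml B \<Longrightarrow> S \<turnstile>pml Conj A B"
  unfolding pml_iff by (meson ConjI Un_least)

lemma pml_ConjE1: "S \<turnstile>pml Conj A B \<Longrightarrow> S \<turnstile>pml A"
  unfolding pml_iff using ConjE1 by blast

lemma pml_ConjE2: "S \<turnstile>pml Conj A B \<Longrightarrow> S \<turnstile>pml B"
  unfolding pml_iff using ConjE2 by blast

lemma pml_DisjI1: "S \<turnstile>pml A \<Longrightarrow> S \<turnstile>pml Disj A B"
  unfolding pml_iff using DisjI1 by blast

lemma pml_DisjI2: "S \<turnstile>pml B \<Longrightarrow> S \<turnstile>pml Disj A B"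
  unfolding pml_iff using DisjI2 by blast

lemma pml_DisjE:
  assumes "S \<turnstile>pml Disj A B" "insert A S \<turnstile>pml C" "insert B S \<turnstile>pml C"
  shows "S \<turnstile>pml C"
proof -
  obtain G1 where "G1 \<subseteq> S" "sequent G1 (Disj A B)"
    using assms(1) unfolding pml_iff by blast
  moreover obtain G2 where "G2 \<subseteq> S" "sequent (G2 \<union> {A}) C"
    using assms(2) by (rule pml_insertE)
  moreover obtain G3 where "G3 \<subseteq> S" "sequent (G3 \<union> {B}) C"
    using assms(3) by (rule pml_insertE)
  ultimately show ?thesis
    unfolding pml_iff by (meson DisjE Un_least)
qed

lemma pml_ImpI:
  assumes "insert A S \<turnstile>pml B"
  shows "S \<turnstile>pml Imp A B"
  using assms by (rule pml_insertE) (use ImpI pml_iff in blast)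

lemma pml_ImpE: "S \<turnstile>pml Imp A B \<Longrightarrow> S \<turnstile>pml A \<Longrightarrow> S \<turnstile>pml B"
  unfolding pml_iff by (meson ImpE Un_least)

lemma pml_cut: "S \<turnstile>pml A \<Longrightarrow> insert A S \<turnstile>pml B \<Longrightarrow> S \<turnstile>pml B"
  using pml_ImpE pml_ImpI by blast

lemma pml_explosion: "S \<turnstile>pml Bot \<Longrightarrow> intuitionistic A \<Longrightarrow> S \<turnstile>pml A"
  unfolding pml_iff using BotI by blast

lemma pml_double_negation: "S \<turnstile>pml Neg (Neg A) \<Longrightarrow> classical A \<Longrightarrow> S \<turnstile>pml A"
  unfolding pml_iff using BotC by blast

text \<open>
  The double negation of excluded middle is already a theorem of minimal logic, and excluded middle
  for a classical formula is itself a classical formula, so its double negation can be removed.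
\<close>

lemma pml_excluded_middle:
  assumes "classical A"
  shows "S \<turnstile>pml Disj A (Neg A)"
proof (rule pml_double_negation)
  let ?E = "Disj A (Neg A)"
  have "insert A (insert (Neg ?E) S) \<turnstile>pml Bot"
    by (rule pml_ImpE[of _ ?E]) (auto intro: pml_assumption pml_DisjI1)
  then have "insert (Neg ?E) S \<turnstile>pml Neg A"
    by (rule pml_ImpI)
  then have "insert (Neg ?E) S \<turnstile>pml ?E"
    by (rule pml_DisjI2)
  moreover have "insert (Neg ?E) S \<turnstile>pml Neg ?E"
    by (simp add: pml_assumption)
  ultimately have "insert (Neg ?E) S \<turnstile>pml Bot"
    using pml_ImpE by blast
  then show "S \<turnstile>pml Neg (Neg ?E)"
    by (rule pml_ImpI)
  show "classical ?E"
    using assms by (simp add: classical_def)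
qed

section \<open>Prime theories\<close>

text \<open>
  The set of all formulas counts as a prime theory, and a theory may contain \<open>\<bottom>\<close> without
  being trivial, because \<open>\<bottom>\<close> does not entail the minimal variables.
\<close>

definition prime_theory :: "('m, 'i, 'c) form set \<Rightarrow> bool" where
  "prime_theory T \<longleftrightarrow>
     (\<forall>A. T \<turnstile>pml A \<longrightarrow> A \<in> T) \<and> (\<forall>A B. Disj A B \<in> T \<longrightarrow> A \<in> T \<or> B \<in> T)"

lemma prime_theory_derives_iff: "prime_theory T \<Longrightarrow> T \<turnstile>pml A \<longleftrightarrow> A \<in> T"
  unfolding prime_theory_def using pml_assumption by blast

text \<open>
  A set maximal among those that do not derive \<open>A\<close> is closed under derivability by cut. It is prime
  because if it lacked both disjuncts, adding either one would make \<open>A\<close> derivable, and then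
  disjunction elimination would derive \<open>A\<close> from the set itself. Unions of chains are upper bounds,
  as a derivation uses only finitely many assumptions.
\<close>

lemma prime_extension:
  assumes "\<not> S \<turnstile>pml A"
  obtains T where "prime_theory T" "S \<subseteq> T" "A \<notin> T"
proof -
  let ?\<A> = "{T. S \<subseteq> T \<and> \<not> T \<turnstile>pml A}"
  have "\<exists>M\<in>?\<A>. \<forall>T\<in>?\<A>. M \<subseteq> T \<longrightarrow> T = M"
  proof (rule subset_Zorn_nonempty)
    show "?\<A> \<noteq> {}" using assms by blast
  next
    fix \<C> assume \<C>: "\<C> \<noteq> {}" "subset.chain ?\<A> \<C>"
    have "\<not> \<Union>\<C> \<turnstile>pml A"
    proof
      assume "\<Union>\<C> \<turnstile>pml A"
      then obtain G where G: "G \<subseteq> \<Union>\<C>" "sequent G A"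
        unfolding pml_iff by blast
      obtain T where "T \<in> \<C>" "G \<subseteq> T"
        using finite_subset_Union_chain[OF sequent_finite[OF G(2)] G(1) \<C>] by blast
      then show False
        using \<C>(2) G(2) unfolding subset.chain_def pml_iff by blast
    qed
    then show "\<Union>\<C> \<in> ?\<A>"
      using \<C> unfolding subset.chain_def by blast
  qed
  then obtain T where "T \<in> ?\<A>" and max: "\<forall>T'\<in>?\<A>. T \<subseteq> T' \<longrightarrow> T' = T"
    by (rule bexE)
  then have T: "S \<subseteq> T" "\<not> T \<turnstile>pml A"
    by simp_all
  have outside: "insert B T \<turnstile>pml A" if "B \<notin> T" for B
  proof (rule ccontr)
    assume "\<not> insert B T \<turnstile>pml A"
    then have "insert B T \<in> ?\<A>"
      using T(1) by auto
    then have "insert B T = T"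
      using max by (meson subset_insertI)
    then show False
      using that by auto
  qed
  have "prime_theory T"
    unfolding prime_theory_def
  proof (intro conjI allI impI)
    fix B assume "T \<turnstile>pml B"
    then show "B \<in> T"
      using T(2) outside pml_cut by blast
  next
    fix B C assume "Disj B C \<in> T"
    then have "T \<turnstile>pml Disj B C"
      by (rule pml_assumption)
    then show "B \<in> T \<or> C \<in> T"
      using T(2) outside pml_DisjE by blast
  qed
  then show thesis
    using that T pml_assumption by blast
qed

section \<open>The canonical model above a prime theory\<close>

definition canonical_worlds :: "('m, 'i, 'c) form set \<Rightarrow> ('m, 'i, 'c) form set set" where
  "canonical_worlds R = {T. prime_theory T \<and> R \<subseteq> T}"

definition canonical_forcing :: "('m, 'i, 'c) form set \<Rightarrow> ('m, 'i, 'c) atom \<Rightarrow> bool" where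
  "canonical_forcing T p \<longleftrightarrow> Atom p \<in> T"

lemma mixed_kripke_model_canonical:
  fixes R :: "('m, 'i, 'c) form set"
  assumes R: "prime_theory R"
  shows "mixed_kripke_model (canonical_worlds R) (\<subseteq>) canonical_forcing"
proof
  show "canonical_worlds R \<noteq> {}"
    using R unfolding canonical_worlds_def by blast
  show "reflp_on (canonical_worlds R) (\<subseteq>)" "antisymp_on (canonical_worlds R) (\<subseteq>)"
    "transp_on (canonical_worlds R) (\<subseteq>)"
    by (auto intro: reflp_onI antisymp_onI transp_onI)
next
  fix S T :: "('m, 'i, 'c) form set" and p :: "('m, 'i, 'c) atom"
  assume "canonical_forcing S p" "S \<subseteq> T"
  then show "canonical_forcing T p"
    unfolding canonical_forcing_def by blast
next
  fix T :: "('m, 'i, 'c) form set" and p :: "('m, 'i, 'c) atom"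
  assume "T \<in> canonical_worlds R" "canonical_forcing T Falsum" "p \<in> Vi \<union> Vc"
  moreover from \<open>p \<in> Vi \<union> Vc\<close> have "intuitionistic (Atom p)"
    unfolding intuitionistic_def by auto
  ultimately show "canonical_forcing T p"
    unfolding canonical_worlds_def canonical_forcing_def
    using pml_explosion prime_theory_derives_iff by blast
next
  fix S T :: "('m, 'i, 'c) form set" and p :: "('m, 'i, 'c) atom"
  assume S: "S \<in> canonical_worlds R" and T: "T \<in> canonical_worlds R" and "p \<in> Vc"
    and p: "canonical_forcing S p" and bot: "\<not> canonical_forcing S Falsum"
  then have "classical (Atom p)"
    unfolding classical_def by auto
  then have "Atom p \<in> R \<or> Neg (Atom p) \<in> R"
    using R pml_excluded_middle unfolding prime_theory_def by blast
  moreover have "Neg (Atom p) \<notin> R"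
  proof
    assume "Neg (Atom p) \<in> R"
    then have "S \<turnstile>pml Bot"
      using S p pml_ImpE pml_assumption
      unfolding canonical_worlds_def canonical_forcing_def by blast
    then show False
      using S bot prime_theory_derives_iff
      unfolding canonical_worlds_def canonical_forcing_def by blast
  qed
  ultimately show "canonical_forcing T p"
    using T unfolding canonical_worlds_def canonical_forcing_def by blast
qed

text \<open>
  The only case of the truth lemma that needs new worlds is an implication \<open>B \<rightarrow> C\<close> missing from \<open>T\<close>:
  then \<open>T\<close> together with \<open>B\<close> does not derive \<open>C\<close>, and a prime extension of it omitting \<open>C\<close> is
  a world above \<open>T\<close> that refutes the implication.
\<close>

lemma forces_canonical_iff:
  assumes "T \<in> canonical_worlds R"
  shows "forces (canonical_worlds R) (\<subseteq>) canonical_forcing T A \<longleftrightarrow> A \<in> T"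
  using assms
proof (induction A arbitrary: T)
  case (Atom p)
  then show ?case by (simp add: canonical_forcing_def)
next
  case (Conj B C)
  then have T: "prime_theory T" by (simp add: canonical_worlds_def)
  have "Conj B C \<in> T \<longleftrightarrow> B \<in> T \<and> C \<in> T"
    using pml_ConjI pml_ConjE1 pml_ConjE2 by (metis prime_theory_derives_iff[OF T])
  then show ?case using Conj by simp
next
  case (Disj B C)
  then have T: "prime_theory T" by (simp add: canonical_worlds_def)
  have "Disj B C \<in> T \<longleftrightarrow> B \<in> T \<or> C \<in> T"
    using T pml_DisjI1 pml_DisjI2 pml_assumption unfolding prime_theory_def by metis
  then show ?case using Disj by simp
next
  case (Imp B C)
  have "Imp B C \<in> T \<longleftrightarrow> (\<forall>T'\<in>canonical_worlds R. T \<subseteq> T' \<longrightarrow> B \<in> T' \<longrightarrow> C \<in> T')"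
  proof
    assume "Imp B C \<in> T"
    then show "\<forall>T'\<in>canonical_worlds R. T \<subseteq> T' \<longrightarrow> B \<in> T' \<longrightarrow> C \<in> T'"
      unfolding canonical_worlds_def
      using pml_ImpE prime_theory_derives_iff by blast
  next
    assume above: "\<forall>T'\<in>canonical_worlds R. T \<subseteq> T' \<longrightarrow> B \<in> T' \<longrightarrow> C \<in> T'"
    show "Imp B C \<in> T"
    proof (rule ccontr)
      assume "Imp B C \<notin> T"
      then have "\<not> insert B T \<turnstile>pml C"
        using Imp.prems pml_ImpI prime_theory_derives_iff
        unfolding canonical_worlds_def by blast
      then obtain T' where "prime_theory T'" "insert B T \<subseteq> T'" "C \<notin> T'"
        by (rule prime_extension)
      then show False
        using above Imp.prems unfolding canonical_worlds_def by blast
    qed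
  qed
  then show ?case using Imp.IH by simp
qed

section \<open>Completeness\<close>

theorem theorem19:
  fixes \<Gamma> :: "('m :: countable, 'i :: countable, 'c :: countable) form set"
    and A :: "('m, 'i, 'c) form"
  assumes "entails TYPE(('m, 'i, 'c) form set) \<Gamma> A"
  shows "\<Gamma> \<turnstile>pml A"
proof (rule ccontr)
  assume "\<not> \<Gamma> \<turnstile>pml A"
  then obtain R where R: "prime_theory R" "\<Gamma> \<subseteq> R" "A \<notin> R"
    by (rule prime_extension)
  let ?K = "canonical_worlds R"
  have "\<forall>B\<in>\<Gamma>. valid_in ?K (\<subseteq>) canonical_forcing B"
    using R(2) forces_canonical_iff[of _ R]
    unfolding valid_in_def canonical_worlds_def by blast
  then have "valid_in ?K (\<subseteq>) canonical_forcing A"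
    using assms mixed_kripke_model_canonical[OF R(1)] unfolding entails_def by blast
  moreover have "R \<in> ?K"
    using R(1) by (simp add: canonical_worlds_def)
  ultimately show False
    using R(3) forces_canonical_iff unfolding valid_in_def by blast
qed

end
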